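(* Let $r,s,\tilde r,\tilde s\in(0,\infty]$, suppose $T$ is a bounded linear operator from $W_n(L^r,\ell^s)$ to $W_n(L^{\tilde r},\ell^{\tilde s})$ and let $T^*$ be the maximal operator based on $T$ associated to a filtration of Lebesgue measurable subsets of $\mathbb R^n$. If $\max\{r,s\}<\min\{\tilde r,\tilde s\}$, then $T^*$ is bounded from $W_n(L^r,\ell^s)$ to $W_n(L^{\tilde r},\ell^{\tilde s})$ and \[ \|T^*\|_{W_n(L^r,\ell^s)\to W_n(L^{\tilde r},\ell^{\tilde s})}\le\gamma\,\|T\|_{W_n(L^r,\ell^s)\to W_n(L^{\tilde r},\ell^{\tilde s})}, \] where $\gamma$ depends only on $r$, $s$, $\tilde r$ and $\tilde s$. If $\tilde r\ge1$ and $\tilde s\ge1$, then \[ \gamma=\frac{2^{1/q}}{1-(2^{p/q}-1)^{1/p}}, \] where $p=\max\{r,s\}$ and $q=\min\{\tilde r,\tilde s\}$.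
   Context: For $r,s\in(0,\infty)$ the Wiener amalgam space $W_n(L^r,\ell^s)$ is the space of (classes of) Lebesgue measurable functions $f$ on $\mathbb R^n$ with \[ \|f\|_{W_n(L^r,\ell^s)}=\Big(\sum_{k\in\mathbb Z^n}\Big(\int_{Q_k}|f|^r\Big)^{s/r}\Big)^{1/s}<\infty, \] where $Q_k=k+[0,1)^n$, with the usual modifications (essential supremum over $Q_k$, supremum over $k$) when $r$ or $s$ is infinite. Convention: $1/\infty=0$. A filtration is a family $\{A_\alpha:\alpha\in Q\}$ of measurable subsets of $\mathbb R^n$ indexed by a countable totally ordered set $Q$ with $A_\alpha\subset A_{\alpha'}$ whenever $\alpha<\alpha'$. The maximal operator based on $T$ associated to it is $T^*f=\sup_{\alpha\in Q}|T(f\chi_{A_\alpha})|$, and its norm is the least constant $K$ with $\|T^*f\|\le K\|f\|$ for all $f$. *)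

theory Defs
  imports "HOL-Analysis.Analysis" "HOL-Probability.Essential_Supremum"
begin

(* R^n with Lebesgue measure, as functions on {..<n}, so that the dimension n is a number
   that can be quantified over: the constant in the theorem has to be independent of n. *)
definition lebesgue_Rn :: "nat \<Rightarrow> (nat \<Rightarrow> real) measure" where
  "lebesgue_Rn n = completion (Pi\<^sub>M {..<n} (\<lambda>_. lborel))"

definition lattice :: "nat \<Rightarrow> (nat \<Rightarrow> int) set" where
  "lattice n = {..<n} \<rightarrow>\<^sub>E UNIV"

definition cube :: "nat \<Rightarrow> (nat \<Rightarrow> int) \<Rightarrow> (nat \<Rightarrow> real) set" where
  "cube n k = (\<Pi>\<^sub>E i\<in>{..<n}. {of_int (k i)..<of_int (k i) + 1})"

(* Real powers on [0,\<infinity>], for positive exponents only (0 epowr a = 0). *)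
definition epowr :: "ennreal \<Rightarrow> real \<Rightarrow> ennreal"  (infixr "epowr" 80) where
  "x epowr a = (if x = \<infinity> then \<infinity> else ennreal (enn2real x powr a))"

(* Exponents range over (0,\<infinity>] inside ennreal, where 1/\<infinity> = 0.
   The norms take [0,\<infinity>]-valued functions, standing for |f|, because a supremum
   of absolute values may be infinite at some points. *)
definition Lr_norm_on :: "'x measure \<Rightarrow> 'x set \<Rightarrow> ennreal \<Rightarrow> ('x \<Rightarrow> ennreal) \<Rightarrow> ennreal" where
  "Lr_norm_on M Q r g =
     (if r = \<infinity> then esssup (restrict_space M Q) g
      else (\<integral>\<^sup>+x\<in>Q. (g x epowr enn2real r) \<partial>M) epowr (1 / enn2real r))"

definition ls_norm_on :: "'k set \<Rightarrow> ennreal \<Rightarrow> ('k \<Rightarrow> ennreal) \<Rightarrow> ennreal" where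
  "ls_norm_on K s a =
     (if s = \<infinity> then (SUP k\<in>K. a k)
      else (\<Sum>\<^sub>\<infinity>k\<in>K. a k epowr enn2real s) epowr (1 / enn2real s))"

definition amalgam_norm :: "nat \<Rightarrow> ennreal \<Rightarrow> ennreal \<Rightarrow> ((nat \<Rightarrow> real) \<Rightarrow> ennreal) \<Rightarrow> ennreal" where
  "amalgam_norm n r s g =
     ls_norm_on (lattice n) s (\<lambda>k. Lr_norm_on (lebesgue_Rn n) (cube n k) r g)"

definition absf :: "('x \<Rightarrow> 'a::real_normed_vector) \<Rightarrow> 'x \<Rightarrow> ennreal" where
  "absf f = (\<lambda>x. ennreal (norm (f x)))"

(* The sort {real_normed_field, euclidean_space} comprises the scalar fields R and C
   (a finite-dimensional commutative normed division algebra over R is one of these). *)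
definition amalgam_space ::
  "nat \<Rightarrow> ennreal \<Rightarrow> ennreal \<Rightarrow> ((nat \<Rightarrow> real) \<Rightarrow> 'a::{real_normed_field, euclidean_space}) set" where
  "amalgam_space n r s =
     {f \<in> borel_measurable (lebesgue_Rn n). amalgam_norm n r s (absf f) < \<infinity>}"

(* Operators on classes of functions modulo a.e. equality are represented by maps on
   functions that respect a.e. equality; only their values on the amalgam space matter. *)
definition linear_operator ::
  "nat \<Rightarrow> ennreal \<Rightarrow> ennreal \<Rightarrow> ennreal \<Rightarrow> ennreal \<Rightarrow>
   (((nat \<Rightarrow> real) \<Rightarrow> 'a::{real_normed_field, euclidean_space}) \<Rightarrow> ((nat \<Rightarrow> real) \<Rightarrow> 'a)) \<Rightarrow> bool" where
  "linear_operator n r s r' s' T \<longleftrightarrow>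
     (\<forall>f\<in>amalgam_space n r s. T f \<in> amalgam_space n r' s') \<and>
     (\<forall>f\<in>amalgam_space n r s. \<forall>g\<in>amalgam_space n r s.
        (AE x in lebesgue_Rn n. f x = g x) \<longrightarrow> (AE x in lebesgue_Rn n. T f x = T g x)) \<and>
     (\<forall>f\<in>amalgam_space n r s. \<forall>g\<in>amalgam_space n r s.
        AE x in lebesgue_Rn n. T (\<lambda>y. f y + g y) x = T f x + T g x) \<and>
     (\<forall>c. \<forall>f\<in>amalgam_space n r s.
        AE x in lebesgue_Rn n. T (\<lambda>y. c * f y) x = c * T f x)"

(* For S mapping f to |T f| or to T^* f. *)
definition operator_norm ::
  "nat \<Rightarrow> ennreal \<Rightarrow> ennreal \<Rightarrow> ennreal \<Rightarrow> ennreal \<Rightarrow>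
   (((nat \<Rightarrow> real) \<Rightarrow> 'a::{real_normed_field, euclidean_space}) \<Rightarrow> ((nat \<Rightarrow> real) \<Rightarrow> ennreal)) \<Rightarrow> ennreal" where
  "operator_norm n r s r' s' S =
     Inf {K. \<forall>f\<in>amalgam_space n r s. amalgam_norm n r' s' (S f) \<le> K * amalgam_norm n r s (absf f)}"

definition bounded_operator ::
  "nat \<Rightarrow> ennreal \<Rightarrow> ennreal \<Rightarrow> ennreal \<Rightarrow> ennreal \<Rightarrow>
   (((nat \<Rightarrow> real) \<Rightarrow> 'a::{real_normed_field, euclidean_space}) \<Rightarrow> ((nat \<Rightarrow> real) \<Rightarrow> ennreal)) \<Rightarrow> bool" where
  "bounded_operator n r s r' s' S \<longleftrightarrow>
     (\<forall>f\<in>amalgam_space n r s. S f \<in> borel_measurable (lebesgue_Rn n) \<and> amalgam_norm n r' s' (S f) < \<infinity>) \<and>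
     operator_norm n r s r' s' S < \<infinity>"

(* The totally ordered index set is (I, R), with R the non-strict order. *)
definition filtration ::
  "nat \<Rightarrow> 'i set \<Rightarrow> 'i rel \<Rightarrow> ('i \<Rightarrow> (nat \<Rightarrow> real) set) \<Rightarrow> bool" where
  "filtration n I R A \<longleftrightarrow>
     countable I \<and> linear_order_on I R \<and>
     (\<forall>\<alpha>\<in>I. A \<alpha> \<in> sets (lebesgue_Rn n)) \<and>
     (\<forall>\<alpha> \<beta>. (\<alpha>, \<beta>) \<in> R \<and> \<alpha> \<noteq> \<beta> \<longrightarrow> A \<alpha> \<subseteq> A \<beta>)"

definition maximal_operator ::
  "(((nat \<Rightarrow> real) \<Rightarrow> 'a::{real_normed_field, euclidean_space}) \<Rightarrow> ((nat \<Rightarrow> real) \<Rightarrow> 'a)) \<Rightarrow>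
   'i set \<Rightarrow> ('i \<Rightarrow> (nat \<Rightarrow> real) set) \<Rightarrow> ((nat \<Rightarrow> real) \<Rightarrow> 'a) \<Rightarrow> (nat \<Rightarrow> real) \<Rightarrow> ennreal" where
  "maximal_operator T I A f =
     (\<lambda>x. SUP \<alpha>\<in>I. ennreal (norm (T (\<lambda>y. f y * indicator (A \<alpha>) y) x)))"

end

theory Submission
  imports Defs
begin

text \<open>
  The argument is that of Christ and Kiselev, and it uses the exponents only through two estimates. In the
  domain, where \<open>r, s \<le> p\<close>, a measurable set B gives
  \<open>\<parallel>f 1\<^sub>B\<parallel> ^ p + \<parallel>f 1\<^bsub>- B\<^esub>\<parallel> ^ p \<le> \<parallel>f\<parallel> ^ p\<close> (\<open>amalgam_norm_lower_estimate\<close>). In the target, where \<open>q \<le> r', s'\<close>,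
  there is \<open>\<parallel>max g h\<parallel> ^ q \<le> \<parallel>g\<parallel> ^ q + \<parallel>h\<parallel> ^ q\<close>, and with \<open>\<theta> = min 1 q\<close> also
  \<open>\<parallel>g + h\<parallel> ^ \<theta> \<le> \<parallel>g\<parallel> ^ \<theta> + \<parallel>h\<parallel> ^ \<theta>\<close> (\<open>amalgam_norm_upper_estimate\<close>). Both come from Minkowski's inequality, applied
  first on the cubes and then to the sequence of cube norms.

  For a finite chain of sets let \<open>\<mu> = 2 powr (- (p / q))\<close> and let m be the first member with
  \<open>\<parallel>f 1\<^sub>m\<parallel> ^ p > \<mu> \<parallel>f\<parallel> ^ p\<close>, or the largest member
  if there is none. Members below m only see a function of norm at most \<open>\<mu> powr (1/p) \<parallel>f\<parallel>\<close>. For a member B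
  above m, linearity gives \<open>T (f 1\<^sub>B) = T (f 1\<^sub>m) + T (f 1\<^bsub>B - m\<^esub>)\<close>, and f has norm at most
  \<open>(1 - \<mu>) powr (1/p) \<parallel>f\<parallel>\<close> outside m. Hence a bound with constant C (times the norm of T) for both shorter chains gives
  the bound with constant \<open>((C \<mu> powr (1/p)) ^ q + D ^ q) ^ (1/q)\<close> for the whole chain, where
  \<open>D ^ \<theta> = 1 + (C (1 - \<mu>) powr (1/p)) ^ \<theta>\<close>. Since \<open>p < q\<close>, there is a positive C that this recursion reproduces
  (\<open>christ_kiselev_const_eq\<close>); for \<open>\<theta> = 1\<close> it is the asserted constant (\<open>christ_kiselev_const_1\<close>). So the bound holds
  for all finite chains (\<open>maximal_operator_finite_chain\<close>), and by monotone convergence for all countable ones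
  (\<open>maximal_operator_filtration\<close>). For \<open>q = \<infinity>\<close> the target carries a supremum norm and the bound is immediate with
  constant 1.
\<close>

section \<open>Powers of extended nonnegative numbers\<close>

lemma epowr_top [simp]: "\<infinity> epowr a = \<infinity>" "top epowr a = top"
  by (simp_all add: epowr_def)

lemma epowr_ennreal: "0 \<le> x \<Longrightarrow> ennreal x epowr a = ennreal (x powr a)"
  by (simp add: epowr_def)

lemma epowr_0 [simp]: "0 epowr a = 0"
  by (simp add: epowr_def)

lemma epowr_1 [simp]: "x epowr 1 = x"
  by (cases x) (simp_all add: epowr_ennreal)

lemma epowr_epowr: "(x epowr a) epowr b = x epowr (a * b)"
  by (cases x) (simp_all add: epowr_ennreal powr_powr)

lemma epowr_mono: "0 \<le> a \<Longrightarrow> x \<le> y \<Longrightarrow> x epowr a \<le> y epowr a"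
  by (cases x; cases y) (auto simp: epowr_ennreal powr_mono2 top_unique)

lemma epowr_cancel: "0 < a \<Longrightarrow> (x epowr a) epowr (1 / a) = x"
  "0 < a \<Longrightarrow> (x epowr (1 / a)) epowr a = x"
  by (simp_all add: epowr_epowr)

lemma epowr_le_iff: "0 < a \<Longrightarrow> x epowr a \<le> y epowr a \<longleftrightarrow> x \<le> y"
  using epowr_mono[of a x y] epowr_mono[of "1 / a" "x epowr a" "y epowr a"]
  by (auto simp: epowr_cancel)

lemma epowr_eq_0_iff: "0 < a \<Longrightarrow> x epowr a = 0 \<longleftrightarrow> x = 0"
  by (metis epowr_0 epowr_cancel(1))

text \<open>
  For a positive exponent, raising to the power is an order isomorphism of [0, \<infinity>]. This adjunction
  turns norm inequalities into inequalities between integrals and makes powers commute with suprema.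
\<close>

lemma epowr_le_swap: "0 < a \<Longrightarrow> x epowr a \<le> y \<longleftrightarrow> x \<le> y epowr (1 / a)"
  by (metis epowr_le_iff epowr_cancel(2))

lemma epowr_mult: "0 < a \<Longrightarrow> (x * y) epowr a = x epowr a * y epowr a"
proof (cases x; cases y)
  fix r t :: real assume "0 \<le> r" "x = ennreal r" "0 \<le> t" "y = ennreal t"
  then show ?thesis by (simp add: epowr_ennreal powr_mult flip: ennreal_mult)
qed (auto simp: epowr_ennreal ennreal_mult_eq_top_iff ennreal_mult_top ennreal_top_mult)

lemma epowr_add_exponent: "0 < a \<Longrightarrow> 0 < b \<Longrightarrow> x epowr (a + b) = x epowr a * x epowr b"
  by (cases x) (simp_all add: epowr_ennreal powr_add flip: ennreal_mult)

lemma epowr_SUP: "0 < a \<Longrightarrow> (SUP i\<in>I. f i) epowr a = (SUP i\<in>I. f i epowr a)"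
proof (rule antisym)
  assume a: "0 < a"
  have "f i \<le> (SUP i\<in>I. f i epowr a) epowr (1 / a)" if "i \<in> I" for i
    unfolding epowr_le_swap[OF a, symmetric] using that by (rule SUP_upper)
  then show "(SUP i\<in>I. f i) epowr a \<le> (SUP i\<in>I. f i epowr a)"
    unfolding epowr_le_swap[OF a] by (rule SUP_least)
  show "(SUP i\<in>I. f i epowr a) \<le> (SUP i\<in>I. f i) epowr a"
    using a by (intro SUP_least epowr_mono SUP_upper) auto
qed

lemma measurable_epowr [measurable]:
  assumes [measurable]: "f \<in> borel_measurable M"
  shows "(\<lambda>x. f x epowr a) \<in> borel_measurable M"
  unfolding epowr_def by measurable

text \<open>
  Because \<open>z epowr t = z * z epowr (t - 1)\<close> and the second factor grows with z. Read with \<open>t = 1 / \<theta>\<close>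
  it says that a sum is at most the corresponding \<open>\<theta>\<close>-sum when \<open>\<theta> \<le> 1\<close>, which replaces the triangle
  inequality in the quasi-normed range.
\<close>

lemma add_epowr_le: "1 \<le> t \<Longrightarrow> x epowr t + y epowr t \<le> (x + y) epowr t"
proof (cases "t = 1")
  case False
  assume "1 \<le> t"
  have *: "z epowr t = z * z epowr (t - 1)" for z
    using epowr_add_exponent[of 1 "t - 1" z] \<open>1 \<le> t\<close> False by simp
  have "x * x epowr (t - 1) + y * y epowr (t - 1) \<le> x * (x + y) epowr (t - 1) + y * (x + y) epowr (t - 1)"
    using \<open>1 \<le> t\<close> by (intro add_mono mult_left_mono epowr_mono) auto
  then show ?thesis by (simp add: * distrib_right)
qed simp

section \<open>Minkowski inequalities\<close>

lemma powr_convex_combination: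
  fixes x y t \<alpha> \<beta> :: real
  assumes t: "1 \<le> t" and "0 \<le> \<alpha>" "0 \<le> \<beta>" "\<alpha> + \<beta> = 1" "0 \<le> x" "0 \<le> y"
  shows "(\<alpha> * x + \<beta> * y) powr t \<le> \<alpha> * x powr t + \<beta> * y powr t"
proof -
  have shrink: "(c * z) powr t \<le> c * z powr t" if "0 \<le> c" "c \<le> 1" "0 \<le> z" for c z :: real
  proof -
    have "c powr t \<le> c"
      using that t powr_mono'[of 1 t c] by (cases "c = 0") auto
    then show ?thesis using that by (simp add: powr_mult mult_right_mono)
  qed
  consider "x = 0" | "y = 0" | "0 < x" "0 < y" using assms by linarith
  then show ?thesis
  proof cases
    case 3
    have "\<alpha> = 1 - \<beta>" "\<beta> \<le> 1" using assms by simp_all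
    then show ?thesis
      using convex_onD[OF powr_convex[OF t], of \<beta> x y] assms(3) 3 by simp
  qed (use assms shrink[of \<beta> y] shrink[of \<alpha> x] in auto)
qed

text \<open>
  Convexity of the power function at the points \<open>x / a\<close> and \<open>y / b\<close> with weights proportional to a
  and b. Equality holds for \<open>(x, y)\<close> proportional to \<open>(a, b)\<close>, so integrating with a suitable choice
  of a and b loses nothing; both Minkowski inequalities below arise in this way.
\<close>

lemma ennreal_weighted_powr_le:
  fixes x y :: ennreal and a b t :: real
  assumes t: "1 \<le> t" and ab: "0 < a" "0 < b"
  shows "(x + y) epowr t \<le> ennreal ((a + b) powr (t - 1)) *
    (ennreal (a powr (1 - t)) * x epowr t + ennreal (b powr (1 - t)) * y epowr t)"
proof (cases "x = \<infinity> \<or> y = \<infinity>")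
  case True
  then show ?thesis using ab by (auto simp: ennreal_mult_top ennreal_mult_eq_top_iff)
next
  case False
  then obtain u v where uv: "0 \<le> u" "x = ennreal u" "0 \<le> v" "y = ennreal v"
    by (cases x; cases y) auto
  have "(u + v) powr t = (a + b) powr t * ((u + v) / (a + b)) powr t"
    using ab uv by (simp add: powr_divide)
  also have "(u + v) / (a + b) = (a / (a + b)) * (u / a) + (b / (a + b)) * (v / b)"
    using ab by (simp add: add_divide_distrib)
  also have "\<dots> powr t \<le> (a / (a + b)) * (u / a) powr t + (b / (a + b)) * (v / b) powr t"
    using ab uv by (intro powr_convex_combination t) (auto simp flip: add_divide_distrib)
  also have "(a + b) powr t * \<dots> = (a + b) powr (t - 1) * (a powr (1 - t) * u powr t + b powr (1 - t) * v powr t)"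
    using ab uv by (simp add: powr_divide powr_diff distrib_left mult_ac)
  finally show ?thesis
    using uv ab by (simp add: epowr_ennreal flip: ennreal_plus ennreal_mult)
qed

text \<open>
  The pointwise bound is integrated with a and b equal to the two norms on the right. They must be
  positive and finite there, whence the separate degenerate cases.
\<close>

lemma Minkowski_nn_integral:
  assumes t: "1 \<le> t" and [measurable]: "u \<in> borel_measurable M" "v \<in> borel_measurable M"
  shows "(\<integral>\<^sup>+x. (u x + v x) epowr t \<partial>M) epowr (1 / t) \<le>
    (\<integral>\<^sup>+x. u x epowr t \<partial>M) epowr (1 / t) + (\<integral>\<^sup>+x. v x epowr t \<partial>M) epowr (1 / t)"
    (is "?L epowr _ \<le> ?A epowr _ + ?B epowr _")
proof -
  consider "?A = \<infinity> \<or> ?B = \<infinity>" | "?A = 0" | "?B = 0"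
    | a b where "0 < a" "0 < b" "?A = ennreal (a powr t)" "?B = ennreal (b powr t)"
  proof (cases "?A = \<infinity> \<or> ?B = \<infinity> \<or> ?A = 0 \<or> ?B = 0")
    case False
    then obtain a b where "?A = ennreal a" "0 < a" "?B = ennreal b" "0 < b"
      by (cases ?A; cases ?B) (auto simp: less_le)
    then show ?thesis using t that(4)[of "a powr (1/t)" "b powr (1/t)"] by (auto simp: powr_powr)
  qed (use that in blast)
  then show ?thesis
  proof cases
    case 1
    then show ?thesis by auto
  next
    case 2
    then have "AE x in M. u x epowr t = 0" by (subst (asm) nn_integral_0_iff_AE) auto
    then have "AE x in M. u x = 0" using t by (simp add: epowr_eq_0_iff)
    then have "?L = ?B" by (intro nn_integral_cong_AE) (auto elim!: eventually_mono)
    then show ?thesis by simp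
  next
    case 3
    then have "AE x in M. v x epowr t = 0" by (subst (asm) nn_integral_0_iff_AE) auto
    then have "AE x in M. v x = 0" using t by (simp add: epowr_eq_0_iff)
    then have "?L = ?A" by (intro nn_integral_cong_AE) (auto elim!: eventually_mono)
    then show ?thesis by simp
  next
    case (4 a b)
    have "?L \<le> (\<integral>\<^sup>+x. ennreal ((a + b) powr (t - 1)) *
      (ennreal (a powr (1 - t)) * u x epowr t + ennreal (b powr (1 - t)) * v x epowr t) \<partial>M)"
      using 4 t by (intro nn_integral_mono ennreal_weighted_powr_le)
    also have "\<dots> = ennreal ((a + b) powr (t - 1)) *
      (ennreal (a powr (1 - t)) * ?A + ennreal (b powr (1 - t)) * ?B)"
      by (simp add: nn_integral_cmult nn_integral_add)
    also have "\<dots> = ennreal ((a + b) powr t)"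
      using 4 by (simp add: powr_diff flip: ennreal_plus ennreal_mult)
    finally have "?L epowr (1 / t) \<le> ennreal ((a + b) powr t) epowr (1 / t)"
      using t by (intro epowr_mono) auto
    then show ?thesis
      using 4 t by (simp add: epowr_ennreal powr_powr)
  qed
qed

text \<open>
  Minkowski's integral inequality for a two-point space: the \<open>l\<^sup>t\<close> norm of the pair of integrals is at
  most the integral of the \<open>l\<^sup>t\<close> norm. With a and b the two integrals, the integrand on
  the right dominates its tangent functional at \<open>(a, b)\<close>, and this functional integrates to the left side.
\<close>

lemma reverse_Minkowski_nn_integral:
  assumes t: "1 \<le> t" and [measurable]: "u \<in> borel_measurable M" "v \<in> borel_measurable M"
  shows "(\<integral>\<^sup>+x. u x \<partial>M) epowr t + (\<integral>\<^sup>+x. v x \<partial>M) epowr t \<le>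
    (\<integral>\<^sup>+x. (u x epowr t + v x epowr t) epowr (1 / t) \<partial>M) epowr t"
    (is "?A epowr t + ?B epowr t \<le> ?R epowr t")
proof -
  have uR: "?A \<le> ?R" and vR: "?B \<le> ?R"
    using t by (auto intro!: nn_integral_mono simp flip: epowr_le_swap)
  consider "?A = \<infinity> \<or> ?B = \<infinity>" | "?A = 0" | "?B = 0"
    | a b where "0 < a" "0 < b" "?A = ennreal a" "?B = ennreal b"
    by (cases ?A; cases ?B) (auto simp: less_le)
  then show ?thesis
  proof cases
    case 1
    then have "?R = \<infinity>" using uR vR by (auto simp: top_unique)
    then show ?thesis by simp
  next
    case 2
    then show ?thesis using vR t by (simp add: epowr_mono)
  next
    case 3
    then show ?thesis using uR t by (simp add: epowr_mono)
  next
    case (4 a b)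
    define S where "S = a powr t + b powr t"
    have S: "0 < S" using 4 by (simp add: S_def add_pos_pos)
    \<comment> \<open>Hoelder's inequality for pairs: the weighted bound with \<open>a powr t\<close>, \<open>b powr t\<close> in place of a, b
      and the arguments scaled so that the weights cancel.\<close>
    have pw: "ennreal (a powr (t - 1)) * u x + ennreal (b powr (t - 1)) * v x \<le>
      ennreal (S powr ((t - 1) / t)) * (u x epowr t + v x epowr t) epowr (1 / t)" for x
    proof -
      have *: "ennreal (c powr (t * (1 - t))) * (ennreal (c powr (t - 1)) * z) epowr t = z epowr t"
        if "0 < c" for c :: real and z
      proof -
        have "ennreal (c powr (t * (1 - t))) * (ennreal (c powr (t - 1))) epowr t = 1"
          using that t by (simp add: epowr_ennreal powr_powr algebra_simps flip: ennreal_mult powr_add)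
        then show ?thesis using t by (simp add: epowr_mult mult.assoc[symmetric])
      qed
      have "(ennreal (a powr (t - 1)) * u x + ennreal (b powr (t - 1)) * v x) epowr t \<le>
        ennreal (S powr (t - 1)) * (u x epowr t + v x epowr t)"
        using ennreal_weighted_powr_le[OF t, of "a powr t" "b powr t"
            "ennreal (a powr (t - 1)) * u x" "ennreal (b powr (t - 1)) * v x"] 4
        by (simp add: S_def powr_powr *)
      then show ?thesis
        using t S by (simp add: epowr_le_swap epowr_mult epowr_ennreal powr_powr)
    qed
    have "ennreal S = ennreal (a powr (t - 1)) * ?A + ennreal (b powr (t - 1)) * ?B"
      using 4 by (simp add: S_def powr_diff flip: ennreal_mult ennreal_plus)
    also have "\<dots> = (\<integral>\<^sup>+x. ennreal (a powr (t - 1)) * u x + ennreal (b powr (t - 1)) * v x \<partial>M)"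
      by (simp add: nn_integral_cmult nn_integral_add)
    also have "\<dots> \<le> (\<integral>\<^sup>+x. ennreal (S powr ((t - 1) / t)) * (u x epowr t + v x epowr t) epowr (1 / t) \<partial>M)"
      by (intro nn_integral_mono pw)
    also have "\<dots> = ennreal (S powr ((t - 1) / t)) * ?R"
      by (simp add: nn_integral_cmult)
    finally have "ennreal (S powr (- ((t - 1) / t))) * ennreal S \<le>
        ennreal (S powr (- ((t - 1) / t))) * (ennreal (S powr ((t - 1) / t)) * ?R)"
      by (rule mult_left_mono) simp
    moreover have "ennreal (S powr (- ((t - 1) / t))) * (ennreal (S powr ((t - 1) / t)) * ?R) = ?R"
      using S by (simp add: mult.assoc[symmetric] flip: ennreal_mult powr_add)
    moreover have "S powr (- ((t - 1) / t)) * S = S powr (1 / t)"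
      using S t powr_add[of S "- ((t - 1) / t)" 1] by (simp add: field_simps)
    ultimately have "ennreal (S powr (1 / t)) \<le> ?R" using S by (simp flip: ennreal_mult)
    then have "ennreal (S powr (1 / t)) epowr t \<le> ?R epowr t" using t by (intro epowr_mono) auto
    then show ?thesis using S t 4 by (simp add: S_def epowr_ennreal powr_powr flip: ennreal_plus)
  qed
qed

section \<open>Upper and lower estimates for Lebesgue norms\<close>

text \<open>
  Integrating over the whole space of the measure makes \<open>l\<^sup>s\<close> the special case of counting measure. Each
  inequality is then proved once and applied to the two layers of the amalgam norm.
\<close>

definition Lr_norm :: "'x measure \<Rightarrow> ennreal \<Rightarrow> ('x \<Rightarrow> ennreal) \<Rightarrow> ennreal" where
  "Lr_norm M r g =
     (if r = \<infinity> then esssup M g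
      else (\<integral>\<^sup>+x. g x epowr enn2real r \<partial>M) epowr (1 / enn2real r))"

lemma Lr_norm_on_eq:
  assumes "Q \<in> sets M"
  shows "Lr_norm_on M Q r g = Lr_norm (restrict_space M Q) r g"
  using assms sets.sets_into_space[OF assms]
  by (simp add: Lr_norm_on_def Lr_norm_def nn_integral_restrict_space Int_absorb2)

lemma nn_integral_count_space_eq_infsum:
  fixes f :: "'k \<Rightarrow> ennreal"
  assumes K: "countable K"
  shows "(\<integral>\<^sup>+k. f k \<partial>count_space K) = (\<Sum>\<^sub>\<infinity>k\<in>K. f k)"
proof -
  define F where "F N = {k\<in>K. to_nat_on K k < N}" for N
  have F: "finite (F N)" "F N \<subseteq> K" for N
    unfolding F_def using K inj_on_to_nat_on[OF K]
    by (auto intro!: finite_imageD[of "to_nat_on K"] intro: finite_subset[of _ "{..<N}"] inj_on_subset)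
  have infsum: "(\<Sum>\<^sub>\<infinity>k\<in>K. f k) = (SUP A\<in>{A. finite A \<and> A \<subseteq> K}. sum f A)"
    by (intro nonneg_infsum_complete) auto
  have "(\<integral>\<^sup>+k. f k \<partial>count_space K) = (\<integral>\<^sup>+k. (SUP N. f k * indicator (F N) k) \<partial>count_space K)"
  proof (intro nn_integral_cong antisym)
    fix k assume k: "k \<in> space (count_space K)"
    then have "f k \<le> f k * indicator (F (Suc (to_nat_on K k))) k"
      by (simp add: F_def)
    also have "\<dots> \<le> (SUP N. f k * indicator (F N) k)" by (rule SUP_upper) simp
    finally show "f k \<le> (SUP N. f k * indicator (F N) k)" .
  qed (auto intro!: SUP_least simp: indicator_def)
  also have "\<dots> = (SUP N. \<integral>\<^sup>+k. f k * indicator (F N) k \<partial>count_space K)"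
    by (intro nn_integral_monotone_convergence_SUP)
      (auto simp: incseq_def le_fun_def F_def indicator_def)
  also have "\<dots> = (SUP N. sum f (F N))"
  proof (intro SUP_cong refl)
    fix N
    show "(\<integral>\<^sup>+k. f k * indicator (F N) k \<partial>count_space K) = sum f (F N)"
      by (subst nn_integral_count_space'[where A = "F N"]) (use F in auto)
  qed
  also have "\<dots> \<le> (\<Sum>\<^sub>\<infinity>k\<in>K. f k)"
    unfolding infsum using F by (auto intro!: SUP_least SUP_upper)
  finally show ?thesis
  proof (rule antisym)
    show "(\<Sum>\<^sub>\<infinity>k\<in>K. f k) \<le> (\<integral>\<^sup>+k. f k \<partial>count_space K)"
      unfolding infsum
    proof (intro SUP_least, clarify)
      fix A assume A: "finite A" "A \<subseteq> K"
      then have "sum f A = (\<integral>\<^sup>+k. f k * indicator A k \<partial>count_space K)"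
        by (subst nn_integral_count_space'[where A = A]) auto
      also have "\<dots> \<le> (\<integral>\<^sup>+k. f k \<partial>count_space K)"
        by (intro nn_integral_mono) (auto simp: indicator_def)
      finally show "sum f A \<le> (\<integral>\<^sup>+k. f k \<partial>count_space K)" .
    qed
  qed
qed

lemma esssup_count_space: "esssup (count_space K) a = (SUP k\<in>K. a k :: ennreal)"
  by (subst esssup_eq_AE) (auto simp: AE_count_space intro!: antisym Inf_lower SUP_upper Inf_greatest SUP_least)

lemma ls_norm_on_eq:
  assumes "countable K"
  shows "ls_norm_on K s a = Lr_norm (count_space K) s a"
  using assms by (simp add: ls_norm_on_def Lr_norm_def esssup_count_space nn_integral_count_space_eq_infsum)

lemma Lr_norm_mono_AE:
  assumes "g \<in> borel_measurable M" "AE x in M. g x \<le> h x"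
  shows "Lr_norm M r g \<le> Lr_norm M r h"
proof (cases "r = \<infinity>")
  case True
  with assms show ?thesis by (simp add: Lr_norm_def esssup_AE_mono)
next
  case False
  then show ?thesis
    unfolding Lr_norm_def using assms(2)
    by (auto intro!: epowr_mono nn_integral_mono_AE elim!: eventually_mono)
qed

lemma ennreal_exponent_cases:
  fixes r :: ennreal
  assumes "0 < r"
  obtains "r = \<infinity>" | \<rho> where "0 < \<rho>" "r = ennreal \<rho>"
  using assms by (cases r) auto

lemma Lr_norm_ennreal:
  "0 < \<rho> \<Longrightarrow> Lr_norm M (ennreal \<rho>) g = (\<integral>\<^sup>+x. g x epowr \<rho> \<partial>M) epowr (1 / \<rho>)"
  by (simp add: Lr_norm_def)

text \<open>
  The Minkowski inequality in \<open>L\<close> with exponent \<open>r / \<theta> \<ge> 1\<close>, applied to \<open>\<theta>\<close>-th powers. It is kept in terms of the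
  operation \<open>(a epowr \<theta> + b epowr \<theta>) epowr (1 / \<theta>)\<close> on both sides so that it can be iterated. This operation dominates
  the maximum for every \<open>\<theta>\<close> and the sum for \<open>\<theta> \<le> 1\<close>.
\<close>

lemma Lr_norm_upper_estimate:
  assumes \<theta>: "0 < \<theta>" "ennreal \<theta> \<le> r"
    and [measurable]: "g \<in> borel_measurable M" "h \<in> borel_measurable M"
  shows "Lr_norm M r (\<lambda>x. (g x epowr \<theta> + h x epowr \<theta>) epowr (1 / \<theta>)) \<le>
    (Lr_norm M r g epowr \<theta> + Lr_norm M r h epowr \<theta>) epowr (1 / \<theta>)"
proof -
  have "0 < r" using \<theta> by (metis ennreal_less_zero_iff less_le_trans)
  then show ?thesis
  proof (cases rule: ennreal_exponent_cases)
    case 1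
    have "AE x in M. (g x epowr \<theta> + h x epowr \<theta>) epowr (1 / \<theta>) \<le>
        (esssup M g epowr \<theta> + esssup M h epowr \<theta>) epowr (1 / \<theta>)"
      using esssup_AE[of g M] esssup_AE[of h M]
      by eventually_elim (use \<theta> in \<open>auto intro!: epowr_mono add_mono\<close>)
    then show ?thesis using 1 by (simp add: Lr_norm_def esssup_I)
  next
    case (2 \<rho>)
    then have t: "1 \<le> \<rho> / \<theta>" using \<theta> by simp
    have "(\<integral>\<^sup>+x. (g x epowr \<theta> + h x epowr \<theta>) epowr (\<rho> / \<theta>) \<partial>M) epowr (\<theta> / \<rho>)
      \<le> (\<integral>\<^sup>+x. g x epowr \<rho> \<partial>M) epowr (\<theta> / \<rho>) + (\<integral>\<^sup>+x. h x epowr \<rho> \<partial>M) epowr (\<theta> / \<rho>)"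
      using Minkowski_nn_integral[OF t, of "\<lambda>x. g x epowr \<theta>" M "\<lambda>x. h x epowr \<theta>"] \<theta>
      by (simp add: epowr_epowr)
    then show ?thesis
      using \<theta> 2 by (simp add: Lr_norm_ennreal epowr_epowr epowr_le_swap[symmetric])
  qed
qed

text \<open>
  The reverse counterpart, for exponents \<open>p \<ge> r\<close>. For g and h with disjoint supports the function on the
  right is \<open>g + h\<close>.
\<close>

lemma Lr_norm_lower_estimate:
  assumes r: "0 < r" "r \<le> ennreal p"
    and [measurable]: "g \<in> borel_measurable M" "h \<in> borel_measurable M"
  shows "(Lr_norm M r g epowr p + Lr_norm M r h epowr p) epowr (1 / p) \<le>
    Lr_norm M r (\<lambda>x. (g x epowr p + h x epowr p) epowr (1 / p))"
  using r(1)
proof (cases rule: ennreal_exponent_cases)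
  case (2 \<rho>)
  then have p: "0 < p" "\<rho> \<le> p" using r by (auto simp: ennreal_le_iff2)
  then have t: "1 \<le> p / \<rho>" using 2 by simp
  have "(\<integral>\<^sup>+x. g x epowr \<rho> \<partial>M) epowr (p / \<rho>) + (\<integral>\<^sup>+x. h x epowr \<rho> \<partial>M) epowr (p / \<rho>)
    \<le> (\<integral>\<^sup>+x. (g x epowr p + h x epowr p) epowr (\<rho> / p) \<partial>M) epowr (p / \<rho>)"
    using reverse_Minkowski_nn_integral[OF t, of "\<lambda>x. g x epowr \<rho>" M "\<lambda>x. h x epowr \<rho>"] 2
    by (simp add: epowr_epowr)
  then have "((\<integral>\<^sup>+x. g x epowr \<rho> \<partial>M) epowr (p / \<rho>) + (\<integral>\<^sup>+x. h x epowr \<rho> \<partial>M) epowr (p / \<rho>)) epowr (1 / p)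
    \<le> ((\<integral>\<^sup>+x. (g x epowr p + h x epowr p) epowr (\<rho> / p) \<partial>M) epowr (p / \<rho>)) epowr (1 / p)"
    using p by (intro epowr_mono) auto
  then show ?thesis using 2 p by (simp add: Lr_norm_ennreal epowr_epowr)
qed (use r in \<open>auto simp: top_unique\<close>)

lemma Lr_norm_SUP_le_of_infinity:
  assumes "countable I" and g: "\<And>i. i \<in> I \<Longrightarrow> g i \<in> borel_measurable M"
  shows "Lr_norm M \<infinity> (\<lambda>x. SUP i\<in>I. g i x) \<le> (SUP i\<in>I. Lr_norm M \<infinity> (g i))"
proof -
  have "AE x in M. \<forall>i\<in>I. g i x \<le> esssup M (g i)"
    using assms(1) by (simp add: AE_ball_countable esssup_AE)
  then have "AE x in M. (SUP i\<in>I. g i x) \<le> (SUP i\<in>I. esssup M (g i))"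
    by eventually_elim (auto intro!: SUP_mono)
  then show ?thesis
    using assms by (auto simp: Lr_norm_def intro!: esssup_I borel_measurable_SUP)
qed

text \<open>
  Monotone convergence, which allows the passage from finite to countable filtrations.
\<close>

lemma Lr_norm_SUP_le_incseq:
  assumes r: "0 < r" and g: "\<And>i. g i \<in> borel_measurable M" and inc: "\<And>x. incseq (\<lambda>i. g i x)"
  shows "Lr_norm M r (\<lambda>x. SUP i. g i x) \<le> (SUP i. Lr_norm M r (g i))"
  using r
proof (cases rule: ennreal_exponent_cases)
  case 1
  then show ?thesis using Lr_norm_SUP_le_of_infinity[of UNIV g M] g by simp
next
  case (2 \<rho>)
  have "(\<integral>\<^sup>+x. (SUP i. g i x) epowr \<rho> \<partial>M) = (SUP i. \<integral>\<^sup>+x. g i x epowr \<rho> \<partial>M)"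
    unfolding epowr_SUP[OF 2(1)] using 2 inc g
    by (intro nn_integral_monotone_convergence_SUP)
      (auto simp: incseq_def le_fun_def intro!: epowr_mono)
  then show ?thesis using 2 by (simp add: Lr_norm_ennreal epowr_SUP)
qed

section \<open>Estimates for amalgam norms\<close>

lemma cube_in_sets: "cube n k \<in> sets (lebesgue_Rn n)"
  unfolding lebesgue_Rn_def cube_def
  by (rule sets_completionI_sets) (auto intro!: sets_PiM_I_finite)

lemma countable_lattice: "countable (lattice n)"
  unfolding lattice_def by (intro countable_PiE) auto

abbreviation cube_measure where
  "cube_measure n k \<equiv> restrict_space (lebesgue_Rn n) (cube n k)"

lemma amalgam_norm_eq:
  "amalgam_norm n r s g =
     Lr_norm (count_space (lattice n)) s (\<lambda>k. Lr_norm (cube_measure n k) r g)"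
  by (simp add: amalgam_norm_def ls_norm_on_eq countable_lattice Lr_norm_on_eq cube_in_sets)

lemma AE_cube_measure:
  "AE x in lebesgue_Rn n. P x \<Longrightarrow> AE x in cube_measure n k. P x"
  by (subst AE_restrict_space_iff) (auto intro: sets.Int cube_in_sets elim: eventually_mono)

lemma amalgam_norm_mono_AE:
  assumes "g \<in> borel_measurable (lebesgue_Rn n)" "AE x in lebesgue_Rn n. g x \<le> h x"
  shows "amalgam_norm n r s g \<le> amalgam_norm n r s h"
  unfolding amalgam_norm_eq using assms
  by (intro Lr_norm_mono_AE) (auto intro!: Lr_norm_mono_AE AE_cube_measure measurable_restrict_space1)

lemma amalgam_norm_cong_AE:
  assumes "g \<in> borel_measurable (lebesgue_Rn n)" "h \<in> borel_measurable (lebesgue_Rn n)"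
    "AE x in lebesgue_Rn n. g x = h x"
  shows "amalgam_norm n r s g = amalgam_norm n r s h"
  using assms by (intro antisym amalgam_norm_mono_AE) (auto elim: eventually_mono)

text \<open>
  The estimate holds on each cube with exponent r and then for the sequence of cube norms with exponent s, so
  \<open>\<theta>\<close> has to stay below both.
\<close>

lemma amalgam_norm_upper_estimate:
  assumes \<theta>: "0 < \<theta>" "ennreal \<theta> \<le> r" "ennreal \<theta> \<le> s"
    and g: "g \<in> borel_measurable (lebesgue_Rn n)" "h \<in> borel_measurable (lebesgue_Rn n)"
  shows "amalgam_norm n r s (\<lambda>x. (g x epowr \<theta> + h x epowr \<theta>) epowr (1 / \<theta>)) epowr \<theta> \<le>
    amalgam_norm n r s g epowr \<theta> + amalgam_norm n r s h epowr \<theta>"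
proof -
  have "amalgam_norm n r s (\<lambda>x. (g x epowr \<theta> + h x epowr \<theta>) epowr (1 / \<theta>)) \<le>
    Lr_norm (count_space (lattice n)) s (\<lambda>k. (Lr_norm (cube_measure n k) r g epowr \<theta> +
      Lr_norm (cube_measure n k) r h epowr \<theta>) epowr (1 / \<theta>))"
    unfolding amalgam_norm_eq using \<theta> g
    by (intro Lr_norm_mono_AE AE_I2 Lr_norm_upper_estimate) (auto intro!: measurable_restrict_space1)
  also have "\<dots> \<le> (amalgam_norm n r s g epowr \<theta> + amalgam_norm n r s h epowr \<theta>) epowr (1 / \<theta>)"
    unfolding amalgam_norm_eq using \<theta> by (intro Lr_norm_upper_estimate) auto
  finally show ?thesis using \<theta> by (simp add: epowr_le_swap)
qed

text \<open>
  In the same way, p has to stay above both exponents.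
\<close>

lemma amalgam_norm_lower_estimate:
  assumes r: "0 < r" "r \<le> ennreal p" "0 < s" "s \<le> ennreal p"
    and g: "g \<in> borel_measurable (lebesgue_Rn n)" "h \<in> borel_measurable (lebesgue_Rn n)"
  shows "amalgam_norm n r s g epowr p + amalgam_norm n r s h epowr p \<le>
    amalgam_norm n r s (\<lambda>x. (g x epowr p + h x epowr p) epowr (1 / p)) epowr p"
proof -
  have p: "0 < p" using r by (metis ennreal_less_zero_iff less_le_trans)
  have "(amalgam_norm n r s g epowr p + amalgam_norm n r s h epowr p) epowr (1 / p) \<le>
    Lr_norm (count_space (lattice n)) s (\<lambda>k. (Lr_norm (cube_measure n k) r g epowr p +
      Lr_norm (cube_measure n k) r h epowr p) epowr (1 / p))"
    unfolding amalgam_norm_eq using r by (intro Lr_norm_lower_estimate) auto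
  also have "\<dots> \<le> amalgam_norm n r s (\<lambda>x. (g x epowr p + h x epowr p) epowr (1 / p))"
    unfolding amalgam_norm_eq using r g
    by (intro Lr_norm_mono_AE AE_I2 Lr_norm_lower_estimate) (auto intro!: measurable_restrict_space1)
  finally show ?thesis using epowr_le_swap[of "1 / p"] p by simp
qed

lemma amalgam_norm_SUP_le_incseq:
  assumes "0 < r" "0 < s" and g: "\<And>i. g i \<in> borel_measurable (lebesgue_Rn n)"
    and inc: "\<And>x. incseq (\<lambda>i. g i x)"
  shows "amalgam_norm n r s (\<lambda>x. SUP i. g i x) \<le> (SUP i. amalgam_norm n r s (g i))"
proof -
  have "amalgam_norm n r s (\<lambda>x. SUP i. g i x) \<le>
    Lr_norm (count_space (lattice n)) s (\<lambda>k. SUP i. Lr_norm (cube_measure n k) r (g i))"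
    unfolding amalgam_norm_eq using assms
    by (intro Lr_norm_mono_AE AE_I2 Lr_norm_SUP_le_incseq) (auto intro!: measurable_restrict_space1)
  also have "\<dots> \<le> (SUP i. amalgam_norm n r s (g i))"
    unfolding amalgam_norm_eq using assms
    by (intro Lr_norm_SUP_le_incseq)
      (auto simp: incseq_def intro!: measurable_restrict_space1 Lr_norm_mono_AE)
  finally show ?thesis .
qed

lemma amalgam_norm_SUP_le_of_infinity:
  assumes "countable I" and g: "\<And>i. i \<in> I \<Longrightarrow> g i \<in> borel_measurable (lebesgue_Rn n)"
  shows "amalgam_norm n \<infinity> \<infinity> (\<lambda>x. SUP i\<in>I. g i x) \<le> (SUP i\<in>I. amalgam_norm n \<infinity> \<infinity> (g i))"
proof -
  have "amalgam_norm n \<infinity> \<infinity> (\<lambda>x. SUP i\<in>I. g i x) \<le>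
    Lr_norm (count_space (lattice n)) \<infinity> (\<lambda>k. SUP i\<in>I. Lr_norm (cube_measure n k) \<infinity> (g i))"
    unfolding amalgam_norm_eq using assms
    by (intro Lr_norm_mono_AE AE_I2 Lr_norm_SUP_le_of_infinity) (auto intro!: measurable_restrict_space1)
  also have "\<dots> \<le> (SUP i\<in>I. amalgam_norm n \<infinity> \<infinity> (g i))"
    unfolding amalgam_norm_eq using assms by (intro Lr_norm_SUP_le_of_infinity) auto
  finally show ?thesis .
qed

lemma measurable_absf [measurable]:
  fixes f :: "'x \<Rightarrow> 'a::{real_normed_vector, second_countable_topology}"
  assumes [measurable]: "f \<in> borel_measurable M"
  shows "absf f \<in> borel_measurable M"
  unfolding absf_def by measurable

lemma Lr_norm_zero: "0 < r \<Longrightarrow> Lr_norm M r (\<lambda>_. 0) = 0"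
  by (cases rule: ennreal_exponent_cases[of r])
    (auto simp: Lr_norm_ennreal Lr_norm_def intro!: antisym esssup_I)

lemma amalgam_norm_zero: "0 < r \<Longrightarrow> 0 < s \<Longrightarrow> amalgam_norm n r s (\<lambda>_. 0) = 0"
  by (simp add: amalgam_norm_eq Lr_norm_zero)

section \<open>Cutting functions and operator bounds\<close>

context
  fixes n :: nat and f :: "(nat \<Rightarrow> real) \<Rightarrow> 'a::{real_normed_field, euclidean_space}"
    and B :: "(nat \<Rightarrow> real) set"
  assumes f: "f \<in> borel_measurable (lebesgue_Rn n)" and B: "B \<in> sets (lebesgue_Rn n)"
begin

lemma measurable_cut: "(\<lambda>y. f y * indicator B y) \<in> borel_measurable (lebesgue_Rn n)"
  using f B by measurable

lemma amalgam_norm_cut_le: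
  "amalgam_norm n r s (absf (\<lambda>y. f y * indicator B y)) \<le> amalgam_norm n r s (absf f)"
  using measurable_cut
  by (intro amalgam_norm_mono_AE AE_I2 measurable_absf) (auto simp: absf_def indicator_def)

lemma amalgam_space_cut:
  assumes "amalgam_norm n r s (absf f) < \<infinity>"
  shows "(\<lambda>y. f y * indicator B y) \<in> amalgam_space n r s"
  using assms measurable_cut amalgam_norm_cut_le[of r s] by (auto simp: amalgam_space_def)

text \<open>
  What survives of the additivity of \<open>\<integral> \<bar>f\<bar> ^ p\<close> over disjoint sets: a superadditivity, which is the
  direction that limits the mass left for the complement of B.
\<close>

lemma amalgam_norm_cut_complement:
  assumes "0 < r" "r \<le> ennreal p" "0 < s" "s \<le> ennreal p"
  shows "amalgam_norm n r s (absf (\<lambda>y. f y * indicator B y)) epowr p +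
      amalgam_norm n r s (absf (\<lambda>y. f y * indicator (space (lebesgue_Rn n) - B) y)) epowr p
    \<le> amalgam_norm n r s (absf f) epowr p" (is "?g epowr p + ?h epowr p \<le> _")
proof -
  have p: "0 < p" using assms by (metis ennreal_less_zero_iff less_le_trans)
  let ?B' = "space (lebesgue_Rn n) - B"
  have h [measurable]: "(\<lambda>y. f y * indicator ?B' y) \<in> borel_measurable (lebesgue_Rn n)"
    using f B by measurable
  note [measurable] = measurable_cut f
  let ?c = "\<lambda>x. (absf (\<lambda>y. f y * indicator B y) x epowr p + absf (\<lambda>y. f y * indicator ?B' y) x epowr p) epowr (1 / p)"
  have "?g epowr p + ?h epowr p \<le> amalgam_norm n r s ?c epowr p"
    using assms by (intro amalgam_norm_lower_estimate) auto
  also have "amalgam_norm n r s ?c = amalgam_norm n r s (absf f)"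
  proof (rule amalgam_norm_cong_AE)
    show "AE x in lebesgue_Rn n. ?c x = absf f x"
      using p by (intro AE_I2) (auto simp: absf_def indicator_def epowr_cancel)
  qed measurable
  finally show ?thesis .
qed

end

lemma cut_cut: "(\<lambda>y. (f y * indicator A y) * indicator B y) = (\<lambda>y. f y * (indicator (A \<inter> B) y :: 'b::{comm_semiring_1}))"
  by (auto simp: indicator_def)

lemma linear_operatorD:
  assumes "linear_operator n r s r' s' T"
  shows "f \<in> amalgam_space n r s \<Longrightarrow> T f \<in> borel_measurable (lebesgue_Rn n)"
    and "f \<in> amalgam_space n r s \<Longrightarrow> g \<in> amalgam_space n r s \<Longrightarrow>
      AE x in lebesgue_Rn n. T (\<lambda>y. f y + g y) x = T f x + T g x"
  using assms by (auto simp: linear_operator_def amalgam_space_def)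

lemma measurable_maximal_operator:
  assumes T: "linear_operator n r s r' s' T" and f: "f \<in> amalgam_space n r s"
    and J: "countable J" "\<And>i. i \<in> J \<Longrightarrow> A i \<in> sets (lebesgue_Rn n)"
  shows "maximal_operator T J A f \<in> borel_measurable (lebesgue_Rn n)"
proof -
  have [measurable]: "T (\<lambda>y. f y * indicator (A i) y) \<in> borel_measurable (lebesgue_Rn n)" if "i \<in> J" for i
    using f that J by (intro linear_operatorD[OF T] amalgam_space_cut) (auto simp: amalgam_space_def)
  show ?thesis
    unfolding maximal_operator_def using J by (intro borel_measurable_SUP) measurable
qed

text \<open>
  A finite operator norm is itself a bound, as multiplication by a finite norm passes
  to the infimum.
\<close>

lemma operator_norm_bound:
  assumes f: "f \<in> amalgam_space n r s" and fin: "operator_norm n r s r' s' S < \<infinity>"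
  shows "amalgam_norm n r' s' (S f) \<le> operator_norm n r s r' s' S * amalgam_norm n r s (absf f)"
proof -
  let ?F = "amalgam_norm n r s (absf f)"
  let ?\<K> = "{K. \<forall>f\<in>amalgam_space n r s. amalgam_norm n r' s' (S f) \<le> K * amalgam_norm n r s (absf f)}"
  have K: "amalgam_norm n r' s' (S f) \<le> K * ?F" if "K \<in> ?\<K>" for K
    using that f by auto
  have ne: "?\<K> \<noteq> {}"
  proof
    assume "?\<K> = {}"
    then have "operator_norm n r s r' s' S = Inf {}" by (simp only: operator_norm_def)
    then show False using fin by simp
  qed
  have F: "?F < \<infinity>" using f by (simp add: amalgam_space_def)
  show ?thesis
  proof (cases "?F = 0")
    case True
    then show ?thesis using K ne by auto
  next
    case False
    have "amalgam_norm n r' s' (S f) / ?F \<le> Inf ?\<K>"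
    proof (rule Inf_greatest)
      fix K assume "K \<in> ?\<K>"
      then have "amalgam_norm n r' s' (S f) / ?F \<le> (K * ?F) / ?F" by (intro divide_right_mono_ennreal K)
      also have "\<dots> = K" using False F by (simp add: ennreal_mult_divide_eq)
      finally show "amalgam_norm n r' s' (S f) / ?F \<le> K" .
    qed
    then have "(amalgam_norm n r' s' (S f) / ?F) * ?F \<le> Inf ?\<K> * ?F" by (rule mult_right_mono) simp
    then show ?thesis
      using False F by (simp add: operator_norm_def ennreal_divide_times ennreal_mult_divide_eq)
  qed
qed

section \<open>The constant\<close>

text \<open>
  The recursion for the maximal operator splits the input at the fraction \<open>\<mu>\<close> of its p-th power mass and
  asks for a number C with \<open>C ^ q = (C * \<mu> ^ (1/p)) ^ q + D ^ q\<close> where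
  \<open>D ^ \<theta> = 1 + (C * (1 - \<mu>) ^ (1/p)) ^ \<theta>\<close>. With \<open>\<mu> = 2 powr (- (p / q))\<close> the first summand is exactly half of
  \<open>C ^ q\<close>, hence \<open>D = C * 2 powr (- 1 / q)\<close>, an equation linear in \<open>C ^ \<theta>\<close>; this is its solution.
\<close>

definition christ_kiselev_const :: "real \<Rightarrow> real \<Rightarrow> real \<Rightarrow> real" where
  "christ_kiselev_const \<theta> p q =
     (2 powr (- \<theta> / q) - (1 - 2 powr (- (p / q))) powr (\<theta> / p)) powr (- (1 / \<theta>))"

text \<open>
  This is where \<open>p < q\<close> enters: it makes \<open>\<mu> = 2 powr (- (p / q))\<close> larger than \<open>1 / 2\<close>, hence larger than \<open>1 - \<mu>\<close>.
\<close>

lemma christ_kiselev_const_base_pos: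
  fixes \<theta> p q :: real
  assumes "0 < \<theta>" "0 < p" "p < q"
  shows "0 < 2 powr (- \<theta> / q) - (1 - 2 powr (- (p / q))) powr (\<theta> / p)"
proof -
  have "2 powr (-1) < (2::real) powr (- (p / q))" using assms by (intro powr_less_mono) auto
  then have "1 - 2 powr (- (p / q)) < (2::real) powr (- (p / q))" by (simp add: powr_minus)
  moreover have "(2::real) powr (- (p / q)) \<le> 2 powr 0" using assms by (intro powr_mono) auto
  ultimately have "(1 - 2 powr (- (p / q))) powr (\<theta> / p) < (2 powr (- (p / q))) powr (\<theta> / p)"
    using assms by (intro powr_less_mono2) auto
  then show ?thesis using assms by (simp add: powr_powr)
qed

lemma christ_kiselev_const_eq:
  assumes "0 < \<theta>" "0 < p" "p < q"
  shows "1 + christ_kiselev_const \<theta> p q powr \<theta> * (1 - 2 powr (- (p / q))) powr (\<theta> / p) =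
      christ_kiselev_const \<theta> p q powr \<theta> * 2 powr (- \<theta> / q)"
    and "0 < christ_kiselev_const \<theta> p q"
proof -
  define d where "d = 2 powr (- \<theta> / q) - (1 - 2 powr (- (p / q))) powr (\<theta> / p)"
  have d: "0 < d" unfolding d_def using assms by (rule christ_kiselev_const_base_pos)
  have c: "christ_kiselev_const \<theta> p q = d powr (- (1 / \<theta>))" by (simp only: christ_kiselev_const_def d_def)
  show "0 < christ_kiselev_const \<theta> p q" using d by (simp add: c)
  have "christ_kiselev_const \<theta> p q powr \<theta> = d powr - 1" using assms by (simp add: c powr_powr)
  then have "christ_kiselev_const \<theta> p q powr \<theta> * d = 1" using d by (simp add: powr_neg_one)
  then show "1 + christ_kiselev_const \<theta> p q powr \<theta> * (1 - 2 powr (- (p / q))) powr (\<theta> / p) =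
      christ_kiselev_const \<theta> p q powr \<theta> * 2 powr (- \<theta> / q)"
    by (simp add: d_def right_diff_distrib)
qed

lemma christ_kiselev_const_1:
  assumes "0 < p" "p < q"
  shows "christ_kiselev_const 1 p q = 2 powr (1 / q) / (1 - (2 powr (p / q) - 1) powr (1 / p))"
proof -
  define d where "d = 2 powr (- 1 / q) - (1 - 2 powr (- (p / q))) powr (1 / p)"
  have d: "0 < d" unfolding d_def using assms by (intro christ_kiselev_const_base_pos) auto
  have u: "(2::real) powr (- (p / q)) \<le> 2 powr 0" using assms by (intro powr_mono) auto
  have "(2 powr (p / q) - 1) powr (1 / p) = (2 powr (p / q) * (1 - 2 powr (- (p / q)))) powr (1 / p)"
    by (simp add: right_diff_distrib flip: powr_add)
  also have "\<dots> = 2 powr (1 / q) * (1 - 2 powr (- (p / q))) powr (1 / p)"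
    using assms u by (simp add: powr_mult powr_powr)
  finally have "1 - (2 powr (p / q) - 1) powr (1 / p) = 2 powr (1 / q) * d"
    by (simp add: d_def right_diff_distrib flip: powr_add)
  moreover have "christ_kiselev_const 1 p q = inverse d"
    using d by (simp add: christ_kiselev_const_def d_def powr_minus)
  ultimately show ?thesis using d by (simp add: inverse_eq_divide)
qed

text \<open>
  One step of the recursion in numbers: x bounds the part of the filtration below the splitting set, y the
  part from the splitting set upwards, and N the maximum of both.
\<close>

lemma christ_kiselev_const_combine:
  fixes L x y N :: ennreal and p q \<theta> :: real
  defines "\<mu> \<equiv> 2 powr (- (p / q))" and "C \<equiv> christ_kiselev_const \<theta> p q"
  assumes exps: "0 < \<theta>" "0 < p" "p < q"
    and x: "x \<le> ennreal (C * \<mu> powr (1 / p)) * L"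
    and y: "y epowr \<theta> \<le> L epowr \<theta> + (ennreal (C * (1 - \<mu>) powr (1 / p)) * L) epowr \<theta>"
    and N: "N epowr q \<le> x epowr q + y epowr q"
  shows "N \<le> ennreal C * L"
proof -
  note C = christ_kiselev_const_eq[OF exps, folded \<mu>_def C_def]
  have "\<mu> \<le> 2 powr 0" unfolding \<mu>_def using exps by (intro powr_mono) auto
  then have \<mu>: "0 < \<mu>" "\<mu> \<le> 1" by (simp_all add: \<mu>_def)
  note y
  also have "(ennreal (C * (1 - \<mu>) powr (1 / p)) * L) epowr \<theta> =
      ennreal (C powr \<theta> * (1 - \<mu>) powr (\<theta> / p)) * L epowr \<theta>"
    using exps C(2) \<mu> by (simp add: epowr_mult epowr_ennreal powr_mult powr_powr)
  also have "L epowr \<theta> + \<dots> = ennreal (1 + C powr \<theta> * (1 - \<mu>) powr (\<theta> / p)) * L epowr \<theta>"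
    by (simp add: distrib_right)
  also have "\<dots> = (ennreal (C * 2 powr (- 1 / q)) * L) epowr \<theta>"
    unfolding C(1) using exps C(2) by (simp add: epowr_mult epowr_ennreal powr_mult powr_powr)
  finally have y': "y \<le> ennreal (C * 2 powr (- 1 / q)) * L" using exps by (simp add: epowr_le_iff)
  have half: "(2 powr - (1 / q)) powr q = (1 / 2 :: real)" and half_\<mu>: "(\<mu> powr (1 / p)) powr q = 1 / 2"
    using exps by (simp_all add: \<mu>_def powr_powr powr_neg_one)
  have "N epowr q \<le> (ennreal (C * \<mu> powr (1 / p)) * L) epowr q + (ennreal (C * 2 powr (- 1 / q)) * L) epowr q"
    using exps x y' by (intro order_trans[OF N] add_mono epowr_mono) auto
  also have "(ennreal (C * \<mu> powr (1 / p)) * L) epowr q = ennreal (C powr q / 2) * L epowr q"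
    using exps C(2) by (simp add: epowr_mult epowr_ennreal powr_mult half_\<mu>)
  also have "(ennreal (C * 2 powr (- 1 / q)) * L) epowr q = ennreal (C powr q / 2) * L epowr q"
    using exps C(2) by (simp add: epowr_mult epowr_ennreal powr_mult half)
  also have "ennreal (C powr q / 2) * L epowr q + ennreal (C powr q / 2) * L epowr q
      = ennreal (C powr q / 2 + C powr q / 2) * L epowr q"
    by (simp only: ennreal_plus distrib_right powr_ge_zero divide_nonneg_nonneg zero_le_numeral)
  also have "\<dots> = (ennreal C * L) epowr q"
    using exps C(2) by (simp add: epowr_mult epowr_ennreal)
  finally show ?thesis using exps by (simp add: epowr_le_iff)
qed

section \<open>Maximal operators of finite chains\<close>

text \<open>
  The splitting set m is a minimal member with weight above c, so that smaller members are light. If all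
  members are light, a maximal one serves, and nothing lies above it.
\<close>

lemma finite_family_split:
  fixes w :: "'x set \<Rightarrow> ennreal"
  assumes J: "finite J" "J \<noteq> {}"
  obtains m where "m \<in> J" "\<forall>B\<in>J. B \<subset> m \<longrightarrow> w B \<le> c"
    "{B\<in>J. m \<subset> B} = {} \<or> c < w m"
proof (cases "{B\<in>J. c < w B} = {}")
  case True
  obtain m where "m \<in> J" "\<forall>b\<in>J. m \<subseteq> b \<longrightarrow> m = b" using finite_has_maximal[OF J] by auto
  then show thesis using that[of m] True by (auto simp: not_less)
next
  case False
  then obtain m where m: "m \<in> {B\<in>J. c < w B}" "\<forall>b\<in>{B\<in>J. c < w B}. b \<subseteq> m \<longrightarrow> m = b"
    using finite_has_minimal[of "{B\<in>J. c < w B}"] J by auto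
  show thesis
    by (rule that[of m]) (use m in \<open>force simp: not_less[symmetric]\<close>)+
qed

lemma complement_part_le:
  fixes a b F :: ennreal
  assumes le: "a epowr p + b epowr p \<le> F epowr p" and F: "F < \<infinity>"
    and p: "0 < p" and \<mu>: "0 \<le> \<mu>" "\<mu> \<le> 1" and a: "ennreal (\<mu> powr (1 / p)) * F < a"
  shows "b \<le> ennreal ((1 - \<mu>) powr (1 / p)) * F"
proof -
  obtain \<phi> where \<phi>: "0 \<le> \<phi>" "F = ennreal \<phi>" using F by (cases F) auto
  have fin: "a epowr p \<le> F epowr p" "b epowr p \<le> F epowr p" using le by (auto intro: order_trans[rotated])
  then have "a \<le> F" "b \<le> F" using p by (auto simp: epowr_le_iff)
  then obtain \<alpha> \<beta> where \<alpha>\<beta>: "0 \<le> \<alpha>" "a = ennreal \<alpha>" "0 \<le> \<beta>" "b = ennreal \<beta>"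
    using \<phi> by (cases a; cases b) (auto simp: top_unique)
  have "(ennreal (\<mu> powr (1 / p)) * F) epowr p \<le> a epowr p" using a p by (intro epowr_mono) auto
  then have "\<mu> * \<phi> powr p \<le> \<alpha> powr p"
    using \<alpha>\<beta> \<phi> \<mu> p by (simp add: epowr_mult epowr_ennreal powr_mult powr_powr flip: ennreal_mult)
  moreover have "\<alpha> powr p + \<beta> powr p \<le> \<phi> powr p"
    using le \<alpha>\<beta> \<phi> by (simp add: epowr_ennreal flip: ennreal_plus)
  ultimately have "\<beta> powr p \<le> (1 - \<mu>) * \<phi> powr p" by (simp add: left_diff_distrib)
  then have "b epowr p \<le> (ennreal ((1 - \<mu>) powr (1 / p)) * F) epowr p"
    using \<alpha>\<beta> \<phi> \<mu> p by (simp add: epowr_mult epowr_ennreal powr_mult powr_powr flip: ennreal_mult)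
  then show ?thesis using p by (simp add: epowr_le_iff)
qed

text \<open>
  Induction on the chain. Let m be the splitting set at the fraction \<open>\<mu>\<close> of the p-th power mass. The members
  below m see only f cut to the largest of them, which is light; the members B above m satisfy
  \<open>T (f 1\<^sub>B) = T (f 1\<^sub>m) + T (f 1\<^bsub>B - m\<^esub>)\<close>, and outside m at most the fraction \<open>1 - \<mu>\<close> of the mass is left by the
  lower estimate. The induction hypothesis applies to both parts since m belongs to neither. The
  upper estimate is used twice in the target space: with \<open>\<theta>\<close> for the sum, with q for the maximum. The latter is
  what makes the constant better than the one from the triangle inequality alone.
\<close>

lemma maximal_operator_finite_chain:
  fixes T :: "((nat \<Rightarrow> real) \<Rightarrow> 'a::{real_normed_field, euclidean_space}) \<Rightarrow> ((nat \<Rightarrow> real) \<Rightarrow> 'a)"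
    and p q \<theta> :: real
  assumes T: "linear_operator n r s r' s' T"
    and K: "\<And>f. f \<in> amalgam_space n r s \<Longrightarrow>
      amalgam_norm n r' s' (absf (T f)) \<le> K * amalgam_norm n r s (absf f)"
    and exps: "0 < r" "0 < s" "r \<le> ennreal p" "s \<le> ennreal p" "0 < p" "p < q"
      "ennreal q \<le> r'" "ennreal q \<le> s'" "0 < \<theta>" "\<theta> \<le> 1" "\<theta> \<le> q"
    and J: "finite J" "J \<subseteq> sets (lebesgue_Rn n)" "\<And>A B. A \<in> J \<Longrightarrow> B \<in> J \<Longrightarrow> A \<subseteq> B \<or> B \<subseteq> A"
    and f: "f \<in> amalgam_space n r s"
  shows "amalgam_norm n r' s' (maximal_operator T J (\<lambda>B. B) f)
    \<le> ennreal (christ_kiselev_const \<theta> p q) * (K * amalgam_norm n r s (absf f))"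
  using J f
proof (induction J arbitrary: f rule: finite_psubset_induct)
  case (psubset J f)
  define \<mu> where "\<mu> = 2 powr (- (p / q))"
  define C where "C = christ_kiselev_const \<theta> p q"
  define M where "M \<equiv> \<lambda>J f. maximal_operator T J (\<lambda>B. B) f"
  define F where "F = amalgam_norm n r s (absf f)"
  let ?w = "\<lambda>B. amalgam_norm n r s (absf (\<lambda>y. f y * indicator B y))"
  have r'pos: "0 < r'" "0 < s'"
    using exps by (metis ennreal_less_zero_iff less_le_trans less_trans)+
  have \<theta>q: "ennreal \<theta> \<le> r'" "ennreal \<theta> \<le> s'"
    using exps by (auto intro: order_trans[of _ "ennreal q"] ennreal_leI)
  have "\<mu> \<le> 2 powr 0" unfolding \<mu>_def using exps by (intro powr_mono) auto
  then have \<mu>: "0 < \<mu>" "\<mu> \<le> 1" by (simp_all add: \<mu>_def)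
  have C: "0 < C" using exps by (simp add: C_def christ_kiselev_const_eq)
  have fm: "f \<in> borel_measurable (lebesgue_Rn n)" and fF: "amalgam_norm n r s (absf f) < \<infinity>"
    using psubset.prems by (auto simp: amalgam_space_def)
  show ?case
  proof (cases "J = {}")
    case True
    then show ?thesis using amalgam_norm_zero[OF r'pos] by (simp add: maximal_operator_def bot_ennreal)
  next
    case False
    obtain m where m: "m \<in> J" and small: "\<forall>B\<in>J. B \<subset> m \<longrightarrow> ?w B \<le> ennreal (\<mu> powr (1 / p)) * F"
      and big: "{B\<in>J. m \<subset> B} = {} \<or> ennreal (\<mu> powr (1 / p)) * F < ?w m"
      by (rule finite_family_split[OF psubset.hyps(1) False, of ?w "ennreal (\<mu> powr (1 / p)) * F"]) (rule that)
    define J1 where "J1 = {B\<in>J. B \<subset> m}"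
    define J2 where "J2 = {B\<in>J. m \<subset> B}"
    have J: "J = J1 \<union> {m} \<union> J2" using m psubset.prems(2) by (auto simp: J1_def J2_def)
    have Js: "B \<in> sets (lebesgue_Rn n)" if "B \<in> J" for B using that psubset.prems(1) by auto
    have sub: "J1 \<subset> J" "J2 \<subset> J" using m by (auto simp: J1_def J2_def)
    have J12: "B \<in> sets (lebesgue_Rn n)" if "B \<in> J1 \<or> B \<in> J2" for B using that Js sub by auto
    have fin: "finite J1" "finite J2" using psubset.hyps sub by (auto intro: finite_subset)
    have IH: "amalgam_norm n r' s' (M J' g) \<le> ennreal C * (K * amalgam_norm n r s (absf g))"
      if "J' \<subset> J" "g \<in> amalgam_space n r s" for J' g
      unfolding M_def C_def using that psubset.prems by (intro psubset.IH) auto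
    have cut: "(\<lambda>y. f y * indicator B y) \<in> amalgam_space n r s" if "B \<in> sets (lebesgue_Rn n)" for B
      using that fm fF by (intro amalgam_space_cut)
    \<comment> \<open>U is the union of the members below m, possibly empty.\<close>
    obtain U where U: "U \<in> sets (lebesgue_Rn n)" "\<And>B. B \<in> J1 \<Longrightarrow> B \<subseteq> U" "?w U \<le> ennreal (\<mu> powr (1 / p)) * F"
    proof (cases "J1 = {}")
      case True
      have "?w {} = 0" using amalgam_norm_zero exps by (simp add: absf_def)
      then show thesis using True that[of "{}"] by auto
    next
      case False
      then obtain U where U: "U \<in> J1" "\<forall>B\<in>J1. U \<subseteq> B \<longrightarrow> U = B"
        using finite_has_maximal[of J1] fin by auto
      have "B \<subseteq> U" if "B \<in> J1" for B
        using U that psubset.prems(2)[of U B] by (auto simp: J1_def)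
      then show thesis using U small J12[of U] that[of U] by (auto simp: J1_def)
    qed
    define f1 where "f1 = (\<lambda>y. f y * indicator U y)"
    define S where "S = space (lebesgue_Rn n) - m"
    define f2 where "f2 = (\<lambda>y. f y * indicator S y)"
    have Ss: "S \<in> sets (lebesgue_Rn n)" using Js m by (auto simp: S_def)
    have f12: "f1 \<in> amalgam_space n r s" "f2 \<in> amalgam_space n r s"
      using cut U Ss by (auto simp: f1_def f2_def)
    have M1: "M J1 f1 = M J1 f"
      unfolding M_def maximal_operator_def f1_def cut_cut using U(2) by (auto simp: Int_absorb1 intro!: SUP_cong)
    have x: "amalgam_norm n r' s' (M J1 f) \<le> ennreal (C * \<mu> powr (1 / p)) * (K * F)"
    proof -
      have "amalgam_norm n r' s' (M J1 f) \<le> ennreal C * (K * amalgam_norm n r s (absf f1))"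
        using IH[OF sub(1) f12(1)] by (simp add: M1)
      also have "\<dots> \<le> ennreal C * (K * (ennreal (\<mu> powr (1 / p)) * F))"
        using U(3) by (intro mult_left_mono) (auto simp: f1_def)
      finally show ?thesis using C by (simp add: ennreal_mult mult_ac)
    qed
    have z: "amalgam_norm n r' s' (M J2 f2) \<le> ennreal (C * (1 - \<mu>) powr (1 / p)) * (K * F)"
    proof (cases "J2 = {}")
      case True
      then show ?thesis using amalgam_norm_zero[OF r'pos] by (simp add: M_def maximal_operator_def bot_ennreal)
    next
      case False
      then have "ennreal (\<mu> powr (1 / p)) * F < ?w m" using big unfolding J2_def by blast
      then have "amalgam_norm n r s (absf f2) \<le> ennreal ((1 - \<mu>) powr (1 / p)) * F"
        using amalgam_norm_cut_complement[OF fm Js[OF m], of r p s] exps \<mu> fF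
        unfolding f2_def S_def F_def
        by (intro complement_part_le[of "?w m"]) auto
      then have "ennreal C * (K * amalgam_norm n r s (absf f2)) \<le> ennreal C * (K * (ennreal ((1 - \<mu>) powr (1 / p)) * F))"
        by (intro mult_left_mono) auto
      with IH[OF sub(2) f12(2)] show ?thesis using C by (simp add: ennreal_mult mult_ac)
    qed
    \<comment> \<open>W dominates the maximal function over the splitting set and all members above it.\<close>
    define Y where "Y = absf (T (\<lambda>y. f y * indicator m y))"
    define W where "W = (\<lambda>x. (Y x epowr \<theta> + M J2 f2 x epowr \<theta>) epowr (1 / \<theta>))"
    have Ym [measurable]: "Y \<in> borel_measurable (lebesgue_Rn n)"
      unfolding Y_def using cut Js m by (intro measurable_absf linear_operatorD[OF T]) auto
    have Mm [measurable]: "M J1 f \<in> borel_measurable (lebesgue_Rn n)" "M J2 f2 \<in> borel_measurable (lebesgue_Rn n)"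
      "M J f \<in> borel_measurable (lebesgue_Rn n)"
      unfolding M_def using psubset.prems f12 J12 Js fin psubset.hyps(1)
      by (auto intro!: measurable_maximal_operator[OF T] countable_finite)
    have Wm [measurable]: "W \<in> borel_measurable (lebesgue_Rn n)" unfolding W_def by measurable
    have Y: "amalgam_norm n r' s' Y \<le> K * F"
    proof -
      have "amalgam_norm n r' s' Y \<le> K * ?w m" unfolding Y_def using cut Js m by (intro K) auto
      also have "\<dots> \<le> K * F" unfolding F_def using fm Js m by (intro mult_left_mono amalgam_norm_cut_le) auto
      finally show ?thesis .
    qed
    have "amalgam_norm n r' s' W epowr \<theta> \<le> amalgam_norm n r' s' Y epowr \<theta> + amalgam_norm n r' s' (M J2 f2) epowr \<theta>"
      unfolding W_def using exps \<theta>q by (intro amalgam_norm_upper_estimate) auto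
    also have "\<dots> \<le> (K * F) epowr \<theta> + (ennreal (C * (1 - \<mu>) powr (1 / p)) * (K * F)) epowr \<theta>"
      using Y z exps by (intro add_mono epowr_mono) auto
    finally have y: "amalgam_norm n r' s' W epowr \<theta> \<le> (K * F) epowr \<theta> + (ennreal (C * (1 - \<mu>) powr (1 / p)) * (K * F)) epowr \<theta>" .
    have split: "AE x in lebesgue_Rn n. \<forall>B\<in>J2. T (\<lambda>y. f y * indicator B y) x =
        T (\<lambda>y. f y * indicator m y) x + T (\<lambda>y. f2 y * indicator B y) x"
    proof (subst AE_ball_countable; intro ballI countable_finite fin)
      fix B assume B: "B \<in> J2"
      then have "m \<subseteq> B" "B \<subseteq> space (lebesgue_Rn n)"
        using J12 sets.sets_into_space by (auto simp: J2_def)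
      then have eq: "(\<lambda>y. f y * indicator B y) = (\<lambda>y. f y * indicator m y + f2 y * indicator B y)"
        by (auto simp: f2_def S_def indicator_def fun_eq_iff)
      show "AE x in lebesgue_Rn n. T (\<lambda>y. f y * indicator B y) x =
          T (\<lambda>y. f y * indicator m y) x + T (\<lambda>y. f2 y * indicator B y) x"
        unfolding eq
      proof (rule linear_operatorD(2)[OF T cut[OF Js[OF m]]])
        show "(\<lambda>y. f2 y * indicator B y) \<in> amalgam_space n r s"
          using f12(2) J12 B by (intro amalgam_space_cut) (auto simp: amalgam_space_def)
      qed
    qed
    have "AE x in lebesgue_Rn n. M J f x \<le> (M J1 f x epowr q + W x epowr q) epowr (1 / q)"
      using split
    proof eventually_elim
      case (elim x)
      have YW: "Y x + M J2 f2 x \<le> W x"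
        using add_epowr_le[of "1 / \<theta>" "Y x epowr \<theta>" "M J2 f2 x epowr \<theta>"] exps
        by (simp add: W_def epowr_cancel)
      have "M J1 f x \<le> (M J1 f x epowr q + W x epowr q) epowr (1 / q)"
        and "W x \<le> (M J1 f x epowr q + W x epowr q) epowr (1 / q)"
        using exps by (simp_all flip: epowr_le_swap)
      then have "max (M J1 f x) (W x) \<le> (M J1 f x epowr q + W x epowr q) epowr (1 / q)" by simp
      moreover have "ennreal (norm (T (\<lambda>y. f y * indicator B y) x)) \<le> max (M J1 f x) (W x)" if B: "B \<in> J" for B
      proof -
        consider "B \<in> J1" | "B = m" | "B \<in> J2" using B J by auto
        then show ?thesis
        proof cases
          case 1
          then show ?thesis unfolding M_def maximal_operator_def le_max_iff_disj by (auto intro: SUP_upper)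
        next
          case 2
          then have "ennreal (norm (T (\<lambda>y. f y * indicator B y) x)) \<le> Y x + M J2 f2 x"
            by (simp add: Y_def absf_def)
          then show ?thesis using YW by (auto simp: le_max_iff_disj)
        next
          case 3
          have "ennreal (norm (T (\<lambda>y. f y * indicator B y) x)) \<le>
              ennreal (norm (T (\<lambda>y. f y * indicator m y) x)) + ennreal (norm (T (\<lambda>y. f2 y * indicator B y) x))"
            using elim 3 by (simp add: norm_triangle_ineq flip: ennreal_plus)
          also have "\<dots> \<le> Y x + M J2 f2 x"
            unfolding Y_def absf_def M_def maximal_operator_def using 3 by (intro add_mono SUP_upper order_refl)
          finally show ?thesis using YW by (auto simp: le_max_iff_disj)
        qed
      qed
      then have "M J f x \<le> max (M J1 f x) (W x)"
        unfolding M_def maximal_operator_def[of T J] by (rule SUP_least)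
      ultimately show ?case by (rule order_trans[rotated])
    qed
    then have "amalgam_norm n r' s' (M J f) \<le> amalgam_norm n r' s' (\<lambda>x. (M J1 f x epowr q + W x epowr q) epowr (1 / q))"
      by (intro amalgam_norm_mono_AE) measurable
    then have "amalgam_norm n r' s' (M J f) epowr q \<le>
        amalgam_norm n r' s' (\<lambda>x. (M J1 f x epowr q + W x epowr q) epowr (1 / q)) epowr q"
      using exps by (intro epowr_mono) auto
    also have "\<dots> \<le> amalgam_norm n r' s' (M J1 f) epowr q + amalgam_norm n r' s' W epowr q"
      using exps by (intro amalgam_norm_upper_estimate) auto
    finally have N: "amalgam_norm n r' s' (M J f) epowr q \<le> amalgam_norm n r' s' (M J1 f) epowr q + amalgam_norm n r' s' W epowr q" .
    show ?thesis
      using christ_kiselev_const_combine[of \<theta> p q, folded \<mu>_def C_def, OF _ _ _ x y N] exps by (simp add: M_def C_def F_def)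
  qed
qed

section \<open>Maximal operators of filtrations\<close>

lemma filtration_chain:
  assumes "filtration n I R A" "\<alpha> \<in> I" "\<beta> \<in> I"
  shows "A \<alpha> \<subseteq> A \<beta> \<or> A \<beta> \<subseteq> A \<alpha>"
  using assms unfolding filtration_def linear_order_on_def total_on_def by (metis order_refl)

lemma maximal_operator_image:
  "maximal_operator T (A ` I) (\<lambda>B. B) f = maximal_operator T I A f"
  by (simp add: maximal_operator_def image_image)

lemma maximal_operator_filtration:
  fixes T :: "((nat \<Rightarrow> real) \<Rightarrow> 'a::{real_normed_field, euclidean_space}) \<Rightarrow> ((nat \<Rightarrow> real) \<Rightarrow> 'a)"
    and p q \<theta> :: real and I :: "nat set"
  assumes T: "linear_operator n r s r' s' T"
    and K: "\<And>f. f \<in> amalgam_space n r s \<Longrightarrow>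
      amalgam_norm n r' s' (absf (T f)) \<le> K * amalgam_norm n r s (absf f)"
    and exps: "0 < r" "0 < s" "r \<le> ennreal p" "s \<le> ennreal p" "0 < p" "p < q"
      "ennreal q \<le> r'" "ennreal q \<le> s'" "0 < \<theta>" "\<theta> \<le> 1" "\<theta> \<le> q"
    and A: "filtration n I R A" and f: "f \<in> amalgam_space n r s"
  shows "amalgam_norm n r' s' (maximal_operator T I A f)
    \<le> ennreal (christ_kiselev_const \<theta> p q) * (K * amalgam_norm n r s (absf f))"
proof -
  let ?I = "\<lambda>N. I \<inter> {..<N}"
  have r'pos: "0 < r'" "0 < s'"
    using exps by (metis ennreal_less_zero_iff less_le_trans less_trans)+
  have As: "A i \<in> sets (lebesgue_Rn n)" if "i \<in> I" for i using A that by (simp add: filtration_def)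
  have "maximal_operator T I A f x = (SUP N. maximal_operator T (?I N) A f x)" for x
  proof -
    have "(\<Union>N. ?I N) = I" by auto
    with SUP_UNION[of "\<lambda>i. ennreal (norm (T (\<lambda>y. f y * indicator (A i) y) x))" ?I UNIV]
    show ?thesis by (simp only: maximal_operator_def)
  qed
  then have "amalgam_norm n r' s' (maximal_operator T I A f)
      = amalgam_norm n r' s' (\<lambda>x. SUP N. maximal_operator T (?I N) A f x)" by presburger
  also have "\<dots> \<le> (SUP N. amalgam_norm n r' s' (maximal_operator T (?I N) A f))"
  proof (intro amalgam_norm_SUP_le_incseq r'pos)
    show "maximal_operator T (?I N) A f \<in> borel_measurable (lebesgue_Rn n)" for N
      using f As by (intro measurable_maximal_operator[OF T] countable_finite) auto
    show "incseq (\<lambda>N. maximal_operator T (?I N) A f x)" for x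
      unfolding maximal_operator_def by (auto simp: incseq_def intro!: SUP_subset_mono)
  qed
  also have "\<dots> \<le> ennreal (christ_kiselev_const \<theta> p q) * (K * amalgam_norm n r s (absf f))"
  proof (rule SUP_least)
    fix N
    have "amalgam_norm n r' s' (maximal_operator T (A ` ?I N) (\<lambda>B. B) f)
        \<le> ennreal (christ_kiselev_const \<theta> p q) * (K * amalgam_norm n r s (absf f))"
      using filtration_chain[OF A] As
      by (intro maximal_operator_finite_chain[OF T K exps _ _ _ f]) auto
    then show "amalgam_norm n r' s' (maximal_operator T (?I N) A f)
        \<le> ennreal (christ_kiselev_const \<theta> p q) * (K * amalgam_norm n r s (absf f))"
      by (simp only: maximal_operator_image)
  qed
  finally show ?thesis .
qed

text \<open>
  The endpoint \<open>q = \<infinity>\<close>: in a space with supremum norm the maximal function costs nothing beyond the uniform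
  bound on its members, so the constant is 1.
\<close>

lemma maximal_operator_filtration_infinity:
  fixes T :: "((nat \<Rightarrow> real) \<Rightarrow> 'a::{real_normed_field, euclidean_space}) \<Rightarrow> ((nat \<Rightarrow> real) \<Rightarrow> 'a)"
  assumes T: "linear_operator n r s \<infinity> \<infinity> T"
    and K: "\<And>f. f \<in> amalgam_space n r s \<Longrightarrow>
      amalgam_norm n \<infinity> \<infinity> (absf (T f)) \<le> K * amalgam_norm n r s (absf f)"
    and A: "filtration n I R A" and f: "f \<in> amalgam_space n r s"
  shows "amalgam_norm n \<infinity> \<infinity> (maximal_operator T I A f) \<le> K * amalgam_norm n r s (absf f)"
proof -
  let ?g = "\<lambda>i. absf (T (\<lambda>y. f y * indicator (A i) y))"
  have fm: "f \<in> borel_measurable (lebesgue_Rn n)" "amalgam_norm n r s (absf f) < \<infinity>"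
    using f by (auto simp: amalgam_space_def)
  have As: "A i \<in> sets (lebesgue_Rn n)" if "i \<in> I" for i using A that by (simp add: filtration_def)
  have cut: "(\<lambda>y. f y * indicator (A i) y) \<in> amalgam_space n r s" if "i \<in> I" for i
    using fm As[OF that] by (intro amalgam_space_cut)
  have "amalgam_norm n \<infinity> \<infinity> (\<lambda>x. SUP i\<in>I. ?g i x) \<le> (SUP i\<in>I. amalgam_norm n \<infinity> \<infinity> (?g i))"
    using A cut by (intro amalgam_norm_SUP_le_of_infinity measurable_absf linear_operatorD[OF T])
      (auto simp: filtration_def)
  also have "\<dots> \<le> K * amalgam_norm n r s (absf f)"
  proof (rule SUP_least)
    fix i assume i: "i \<in> I"
    have "amalgam_norm n \<infinity> \<infinity> (?g i) \<le> K * amalgam_norm n r s (absf (\<lambda>y. f y * indicator (A i) y))"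
      by (intro K cut i)
    also have "\<dots> \<le> K * amalgam_norm n r s (absf f)"
      using fm As[OF i] by (intro mult_left_mono amalgam_norm_cut_le) auto
    finally show "amalgam_norm n \<infinity> \<infinity> (?g i) \<le> K * amalgam_norm n r s (absf f)" .
  qed
  finally show ?thesis by (simp add: maximal_operator_def absf_def)
qed

lemma bounded_operator_maximal_operator:
  assumes T: "linear_operator n r s r' s' T"
    and bdd: "bounded_operator n r s r' s' (\<lambda>f. absf (T f))" and A: "filtration n I R A"
    and le: "\<And>f. f \<in> amalgam_space n r s \<Longrightarrow> amalgam_norm n r' s' (maximal_operator T I A f)
      \<le> ennreal \<gamma> * (operator_norm n r s r' s' (\<lambda>f. absf (T f)) * amalgam_norm n r s (absf f))"
  shows "bounded_operator n r s r' s' (maximal_operator T I A) \<and>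
    operator_norm n r s r' s' (maximal_operator T I A)
      \<le> ennreal \<gamma> * operator_norm n r s r' s' (\<lambda>f. absf (T f))"
proof -
  let ?K = "operator_norm n r s r' s' (\<lambda>f. absf (T f))"
  have K: "?K < \<infinity>" using bdd by (simp add: bounded_operator_def)
  have norm: "operator_norm n r s r' s' (maximal_operator T I A) \<le> ennreal \<gamma> * ?K"
    unfolding operator_norm_def[of _ _ _ _ _ "maximal_operator T I A"]
    using le by (intro Inf_lower) (simp add: mult.assoc)
  moreover have "bounded_operator n r s r' s' (maximal_operator T I A)"
    unfolding bounded_operator_def
  proof (intro conjI ballI)
    fix f :: "(nat \<Rightarrow> real) \<Rightarrow> 'a" assume f: "f \<in> amalgam_space n r s"
    show "maximal_operator T I A f \<in> borel_measurable (lebesgue_Rn n)"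
      using f A by (intro measurable_maximal_operator[OF T]) (auto simp: filtration_def)
    have "ennreal \<gamma> * (?K * amalgam_norm n r s (absf f)) < \<infinity>"
      using K f by (simp add: amalgam_space_def ennreal_mult_less_top)
    with le[OF f] show "amalgam_norm n r' s' (maximal_operator T I A f) < \<infinity>" by (rule le_less_trans)
  next
    have "ennreal \<gamma> * ?K < \<infinity>" using K by (simp add: ennreal_mult_less_top)
    with norm show "operator_norm n r s r' s' (maximal_operator T I A) < \<infinity>" by (rule le_less_trans)
  qed
  ultimately show ?thesis by simp
qed

section \<open>The maximal theorem\<close>

(* gamma is chosen before n, T and the filtration, hence depends on the exponents only.  A countable
   totally ordered index set is, up to isomorphism, a subset I of nat with a linear order R;
   R is unrelated to the usual order of nat. *)
theorem theorem5p2: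
  fixes r s r' s' p q :: ennreal
  assumes "0 < r" and "0 < s" and "0 < r'" and "0 < s'"
    and "p = max r s" and "q = min r' s'"
    and "p < q"
  shows "\<exists>\<gamma>::real.
    (\<forall>(n::nat) (T :: ((nat \<Rightarrow> real) \<Rightarrow> 'a::{real_normed_field, euclidean_space}) \<Rightarrow> ((nat \<Rightarrow> real) \<Rightarrow> 'a))
        (I :: nat set) R A.
       1 \<le> n \<and> linear_operator n r s r' s' T \<and>
       bounded_operator n r s r' s' (\<lambda>f. absf (T f)) \<and>
       filtration n I R A \<longrightarrow>
         bounded_operator n r s r' s' (maximal_operator T I A) \<and>
         operator_norm n r s r' s' (maximal_operator T I A)
           \<le> ennreal \<gamma> * operator_norm n r s r' s' (\<lambda>f. absf (T f))) \<and>
    (1 \<le> r' \<and> 1 \<le> s' \<longrightarrow>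
       \<gamma> = 2 powr enn2real (1 / q)
             / (1 - (2 powr enn2real (p / q) - 1) powr (1 / enn2real p)))"
proof -
  have K: "amalgam_norm n r' s' (absf (T f))
      \<le> operator_norm n r s r' s' (\<lambda>f. absf (T f)) * amalgam_norm n r s (absf f)"
    if "bounded_operator n r s r' s' (\<lambda>f. absf (T f))" "f \<in> amalgam_space n r s"
    for n and T :: "((nat \<Rightarrow> real) \<Rightarrow> 'a) \<Rightarrow> ((nat \<Rightarrow> real) \<Rightarrow> 'a)" and f
    using operator_norm_bound[of f n r s r' s' "\<lambda>f. absf (T f)"] that by (simp add: bounded_operator_def)
  have p: "0 < p" "p < \<infinity>" using assms(1,5) less_le_trans[OF assms(7) top_greatest]
    by (simp_all add: less_max_iff_disj)
  then obtain \<pi> where \<pi>: "0 < \<pi>" "p = ennreal \<pi>" by (cases p) auto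
  show ?thesis
  proof (cases "q = \<infinity>")
    case True
    then have inf: "r' = \<infinity>" "s' = \<infinity>" using assms(6) by (auto simp: min_def top_unique split: if_splits)
    show ?thesis
    proof (intro exI[of _ 1] conjI allI impI; (elim conjE)?)
      fix n and T :: "((nat \<Rightarrow> real) \<Rightarrow> 'a) \<Rightarrow> ((nat \<Rightarrow> real) \<Rightarrow> 'a)" and I :: "nat set" and R A
      assume T: "linear_operator n r s r' s' T" and bdd: "bounded_operator n r s r' s' (\<lambda>f. absf (T f))"
        and A: "filtration n I R A"
      have "amalgam_norm n r' s' (maximal_operator T I A f) \<le> ennreal 1 *
          (operator_norm n r s r' s' (\<lambda>f. absf (T f)) * amalgam_norm n r s (absf f))"
        if "f \<in> amalgam_space n r s" for f
        using maximal_operator_filtration_infinity[OF T[unfolded inf] K[OF bdd, unfolded inf] A that]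
        by (simp add: inf)
      then show "bounded_operator n r s r' s' (maximal_operator T I A)"
        "operator_norm n r s r' s' (maximal_operator T I A)
          \<le> ennreal 1 * operator_norm n r s r' s' (\<lambda>f. absf (T f))"
        using bounded_operator_maximal_operator[OF T bdd A, of 1] by auto
    next
      \<comment> \<open>Here \<open>1 / q = p / q = 0\<close>, so the base of the last power in the denominator vanishes.\<close>
      show "1 = 2 powr enn2real (1 / q) / (1 - (2 powr enn2real (p / q) - 1) powr (1 / enn2real p))"
        using True p by (simp add: ennreal_divide_top)
    qed
  next
    case False
    obtain \<kappa> where \<kappa>: "0 < \<kappa>" "q = ennreal \<kappa>" using False less_trans[OF p(1) assms(7)] by (cases q) auto
    have "\<pi> < \<kappa>" using assms(7) \<pi> \<kappa> by (simp add: ennreal_less_iff)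
    have exps: "r \<le> ennreal \<pi>" "s \<le> ennreal \<pi>" "ennreal \<kappa> \<le> r'" "ennreal \<kappa> \<le> s'"
      using assms(5,6) \<pi> \<kappa> by auto
    \<comment> \<open>The best exponent for which the target norm satisfies the \<open>\<theta>\<close>-triangle inequality.\<close>
    define \<theta> where "\<theta> = min 1 \<kappa>"
    have \<theta>: "0 < \<theta>" "\<theta> \<le> 1" "\<theta> \<le> \<kappa>" using \<kappa> by (auto simp: \<theta>_def)
    show ?thesis
    proof (intro exI[of _ "christ_kiselev_const \<theta> \<pi> \<kappa>"] conjI allI impI; (elim conjE)?)
      fix n and T :: "((nat \<Rightarrow> real) \<Rightarrow> 'a) \<Rightarrow> ((nat \<Rightarrow> real) \<Rightarrow> 'a)" and I :: "nat set" and R A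
      assume T: "linear_operator n r s r' s' T" and bdd: "bounded_operator n r s r' s' (\<lambda>f. absf (T f))"
        and A: "filtration n I R A"
      have "amalgam_norm n r' s' (maximal_operator T I A f) \<le> ennreal (christ_kiselev_const \<theta> \<pi> \<kappa>) *
          (operator_norm n r s r' s' (\<lambda>f. absf (T f)) * amalgam_norm n r s (absf f))"
        if "f \<in> amalgam_space n r s" for f
        using maximal_operator_filtration[OF T K[OF bdd] assms(1,2) exps(1,2) \<pi>(1) \<open>\<pi> < \<kappa>\<close> exps(3,4) \<theta> A that] .
      then show "bounded_operator n r s r' s' (maximal_operator T I A)"
        "operator_norm n r s r' s' (maximal_operator T I A)
          \<le> ennreal (christ_kiselev_const \<theta> \<pi> \<kappa>) * operator_norm n r s r' s' (\<lambda>f. absf (T f))"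
        using bounded_operator_maximal_operator[OF T bdd A, of "christ_kiselev_const \<theta> \<pi> \<kappa>"] by auto
    next
      assume "1 \<le> r'" "1 \<le> s'"
      then have "1 \<le> q" using assms(6) by simp
      then have "1 \<le> \<kappa>" using \<kappa> by simp
      then have "\<theta> = 1" by (simp add: \<theta>_def)
      moreover have "1 / q = ennreal (1 / \<kappa>)" "p / q = ennreal (\<pi> / \<kappa>)"
        using \<kappa> \<pi> divide_ennreal[of 1 \<kappa>] by (simp_all add: divide_ennreal)
      ultimately show "christ_kiselev_const \<theta> \<pi> \<kappa> =
          2 powr enn2real (1 / q) / (1 - (2 powr enn2real (p / q) - 1) powr (1 / enn2real p))"
        using christ_kiselev_const_1[OF \<pi>(1) \<open>\<pi> < \<kappa>\<close>] \<pi> \<kappa> by simp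
    qed
  qed
qed

end
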